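(* Let $\mathcal X$ be a space of inputs equipped with a distance $d$, let $\rho\ge 0$, and let $\approx_\rho$ be the relation on $\mathcal X$ given by $X\approx_\rho X'$ iff $d(X,X')\le\rho$. Suppose $\approx_\rho$ decomposes into relations $\approx_{\rho_1},\dots,\approx_{\rho_N}$ on $\mathcal X$, i.e. $X\approx_\rho X'$ if and only if $X\approx_{\rho_i}X'$ for some $i\in\{1,\dots,N\}$. Let $\mathcal M$ be a randomized mechanism from $\mathcal X$ to a space $\mathcal Z$, with privacy profile $\delta_i:\mathbb R\to[0,1]$ with respect to $\approx_{\rho_i}$ for each $i$, and let $g$ be the $C$-class smoothed classifier induced by $\mathcal M$ and hypothesis tests $\phi_1,\dots,\phi_C:\mathcal Z\to[0,1]$ with $\sum_{c}\phi_c=1$. Let $X\in\mathcal X$, let $c_1$ and $c_2$ be the majority class and the second-majority class at $X$, and let $p_1,p_2\in[0,1]$ satisfy $$\mathbb E_{z\sim\mathcal M(X)}[\phi_{c_1}(z)]\ \ge\ p_1\ >\ p_2\ \ge\ \mathbb E_{z\sim\mathcal M(X)}[\phi_{c_2}(z)].$$ If $$\min_{i\in\{1,\dots,N\}}\Bigl[\ \sup_{\varepsilon\in\mathbb R}e^{-\varepsilon}\bigl(p_1-\delta_i(\varepsilon)\bigr)+\sup_{\varepsilon\in\mathbb R}e^{-\varepsilon}\bigl(1-p_2-\delta_i(\varepsilon)\bigr)\Bigr]\;>\;1,$$ then $g$ is $\rho$-robust at $X$, i.e. $g(X')=g(X)$ for all $X'\approx_\rho X$.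
   Context: A randomized mechanism $\mathcal M$ maps each input $X$ to a probability distribution $\mathcal M(X)$ on $\mathcal Z$. A hypothesis test is a (measurable) function $\phi:\mathcal Z\to[0,1]$, where $\phi(z)$ is the probability of outputting $1$. The $C$-class smoothed classifier ($C\ge2$) induced by $(\mathcal M,\{\phi_c\}_{c=1}^C)$ is $g(X)=\arg\max_{c\in\{1,\dots,C\}}\mathbb E_{z\sim\mathcal M(X)}[\phi_c(z)]$. The majority class at $X$ is the class with the largest value of $\mathbb E_{z\sim\mathcal M(X)}[\phi_c(z)]$ and the second-majority class is the class with the largest such value among the remaining classes. For probability distributions $P,Q$ with densities $p,q$ with respect to a common dominating measure, the hockey-stick divergence is $D^{\mathrm{HS}}_{\alpha}(P\|Q)=\int (p(y)-\alpha q(y))_+\,dy$, $(t)_+=\max\{t,0\}$. The privacy profile of $\mathcal M$ with respect to a (not necessarily symmetric) relation $\approx$ is $\delta(\varepsilon)=\sup_{X\approx X'}D^{\mathrm{HS}}_{e^{\varepsilon}}(\mathcal M(X)\|\mathcal M(X'))$, $\varepsilon\in\mathbb R$. *)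

theory Defs
  imports "HOL-Probability.Probability"
begin

text \<open>
  A mechanism need not depend measurably on its input: the input space \<open>S\<close> carries no sigma-algebra.
\<close>

definition randomized_mechanism ::
    "'x set \<Rightarrow> 'z measure \<Rightarrow> ('x \<Rightarrow> 'z measure) \<Rightarrow> bool" where
  "randomized_mechanism S Z M \<longleftrightarrow> M \<in> S \<rightarrow> space (prob_algebra Z)"

definition hypothesis_test :: "'z measure \<Rightarrow> ('z \<Rightarrow> real) \<Rightarrow> bool" where
  "hypothesis_test Z \<phi> \<longleftrightarrow> \<phi> \<in> borel_measurable Z \<and> (\<forall>z\<in>space Z. \<phi> z \<in> {0..1})"

text \<open>
  The expected score of class \<open>c\<close> at input \<open>x\<close>, for tests \<open>\<phi> c\<close> indexed by the class.
\<close>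

definition class_score ::
    "('x \<Rightarrow> 'z measure) \<Rightarrow> (nat \<Rightarrow> 'z \<Rightarrow> real) \<Rightarrow> 'x \<Rightarrow> nat \<Rightarrow> real" where
  "class_score M \<phi> x c = (\<integral>z. \<phi> c z \<partial>(M x))"

text \<open>
  The argmax may be attained by several classes; any function selecting a maximiser at each input
  counts as an induced classifier, so that no tie-breaking rule is fixed.
\<close>

definition smoothed_classifier ::
    "'x set \<Rightarrow> ('x \<Rightarrow> 'z measure) \<Rightarrow> (nat \<Rightarrow> 'z \<Rightarrow> real) \<Rightarrow> nat \<Rightarrow> ('x \<Rightarrow> nat) \<Rightarrow> bool" where
  "smoothed_classifier S M \<phi> C g \<longleftrightarrow>
     (\<forall>x\<in>S. is_arg_max (class_score M \<phi> x) (\<lambda>c. c \<in> {1..C}) (g x))"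

definition majority_class ::
    "('x \<Rightarrow> 'z measure) \<Rightarrow> (nat \<Rightarrow> 'z \<Rightarrow> real) \<Rightarrow> nat \<Rightarrow> 'x \<Rightarrow> nat \<Rightarrow> bool" where
  "majority_class M \<phi> C x c1 \<longleftrightarrow> is_arg_max (class_score M \<phi> x) (\<lambda>c. c \<in> {1..C}) c1"

definition second_majority_class ::
    "('x \<Rightarrow> 'z measure) \<Rightarrow> (nat \<Rightarrow> 'z \<Rightarrow> real) \<Rightarrow> nat \<Rightarrow> 'x \<Rightarrow> nat \<Rightarrow> nat \<Rightarrow> bool" where
  "second_majority_class M \<phi> C x c1 c2 \<longleftrightarrow>
     is_arg_max (class_score M \<phi> x) (\<lambda>c. c \<in> {1..C} - {c1}) c2"

text \<open>
  The common dominating measure is taken to be \<open>sup P Q\<close>, the least upper bound of \<open>P\<close> and \<open>Q\<close> in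
  the lattice of measures. By \<open>hockey_stick_eq\<close> below, any other dominating measure
  gives the same value.
\<close>

definition hockey_stick :: "real \<Rightarrow> 'z measure \<Rightarrow> 'z measure \<Rightarrow> real" where
  "hockey_stick \<alpha> P Q =
     (\<integral>y. max 0 (enn2real (RN_deriv (sup P Q) P y) - \<alpha> * enn2real (RN_deriv (sup P Q) Q y))
        \<partial>(sup P Q))"

text \<open>
  The supremum is taken in \<open>{0..1}\<close>, where the divergences of probability measures live
  (\<open>hockey_stick_nonneg\<close>, \<open>hockey_stick_le_1\<close>). Inserting \<open>0\<close> only matters for the
  empty relation, whose profile is \<open>0\<close>; the real \<open>Sup {}\<close> would be unspecified.
\<close>

definition privacy_profile :: "('x \<Rightarrow> 'z measure) \<Rightarrow> 'x rel \<Rightarrow> real \<Rightarrow> real" where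
  "privacy_profile M R \<epsilon> =
     Sup (insert 0 {hockey_stick (exp \<epsilon>) (M x) (M x') | x x'. (x, x') \<in> R})"

definition robust_at ::
    "'x set \<Rightarrow> ('x \<Rightarrow> 'x \<Rightarrow> real) \<Rightarrow> real \<Rightarrow> ('x \<Rightarrow> nat) \<Rightarrow> 'x \<Rightarrow> bool" where
  "robust_at S d \<rho> g x \<longleftrightarrow> (\<forall>x'\<in>S. d x' x \<le> \<rho> \<longrightarrow> g x' = g x)"

lemma emeasure_sup_le_add:
  assumes "sets Q = sets P" "A \<in> sets P"
  shows "emeasure (sup P Q) A \<le> emeasure P A + emeasure Q A"
proof -
  have "sup P Q = sup_measure' P Q"
    using assms(1) sets_eq_imp_space_eq[OF assms(1)]
    by (simp add: sup_measure_def sup_lexord_def)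
  then have "emeasure (sup P Q) A = (SUP Y\<in>sets P. emeasure P (A \<inter> Y) + emeasure Q (A \<inter> - Y))"
    using emeasure_sup_measure'[OF assms] by simp
  also have "\<dots> \<le> emeasure P A + emeasure Q A"
    using assms by (intro SUP_least add_mono emeasure_mono) auto
  finally show ?thesis .
qed

lemma absolutely_continuous_sup:
  assumes "sets Q = sets P"
  shows "absolutely_continuous (sup P Q) P" "absolutely_continuous (sup P Q) Q"
proof -
  have s: "sets (sup P Q) = sets P"
    using assms by (simp add: sets_sup)
  have "P \<le> sup P Q" "Q \<le> sup P Q" by simp_all
  then show "absolutely_continuous (sup P Q) P" "absolutely_continuous (sup P Q) Q"
    unfolding absolutely_continuous_def null_sets_def
    using le_measure[of P "sup P Q"] le_measure[of Q "sup P Q"] s assms by auto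
qed

lemma finite_measure_sup:
  assumes "sets Q = sets P" "finite_measure P" "finite_measure Q"
  shows "finite_measure (sup P Q)"
proof
  interpret P: finite_measure P by fact
  interpret Q: finite_measure Q by fact
  have s: "sets (sup P Q) = sets P"
    using assms by (simp add: sets_sup)
  have "emeasure (sup P Q) (space P) \<le> emeasure P (space P) + emeasure Q (space P)"
    using assms by (intro emeasure_sup_le_add) auto
  also have "\<dots> < \<infinity>"
    by (simp add: P.emeasure_finite Q.emeasure_finite less_top[symmetric])
  finally show "emeasure (sup P Q) (space (sup P Q)) \<noteq> \<infinity>"
    using sets_eq_imp_space_eq[OF s] by simp
qed

theorem hockey_stick_eq:
  fixes p q :: "'z \<Rightarrow> real"
  assumes N: "sigma_finite_measure N"
    and fin: "finite_measure P" "finite_measure Q"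
    and p: "p \<in> borel_measurable N" "\<And>y. 0 \<le> p y" "P = density N (\<lambda>y. ennreal (p y))"
    and q: "q \<in> borel_measurable N" "\<And>y. 0 \<le> q y" "Q = density N (\<lambda>y. ennreal (q y))"
  shows "hockey_stick \<alpha> P Q = (\<integral>y. max 0 (p y - \<alpha> * q y) \<partial>N)"
proof -
  define L where "L = sup P Q"
  interpret N: sigma_finite_measure N by fact
  have sP: "sets P = sets N" and sQ: "sets Q = sets N" using p(3) q(3) by simp_all
  have sQP: "sets Q = sets P" using sP sQ by simp
  have sL: "sets L = sets N" unfolding L_def using sP sQ by (simp add: sets_sup)
  interpret L: finite_measure L
    unfolding L_def by (rule finite_measure_sup[OF sQP fin])
  have acP: "absolutely_continuous L P" and acQ: "absolutely_continuous L Q"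
    unfolding L_def using absolutely_continuous_sup[OF sQP] by simp_all
  have acL: "absolutely_continuous N L"
    unfolding absolutely_continuous_def
  proof
    fix A assume A: "A \<in> null_sets N"
    have "absolutely_continuous N P" "absolutely_continuous N Q"
      using p q by (auto intro!: absolutely_continuousI_density)
    with A have "A \<in> null_sets P" "A \<in> null_sets Q"
      unfolding absolutely_continuous_def by auto
    then have "emeasure L A \<le> 0" "A \<in> sets L"
      using emeasure_sup_le_add[OF sQP, of A] sL sP null_setsD2[OF A]
      unfolding L_def by (auto dest!: null_setsD1)
    then show "A \<in> null_sets L" by auto
  qed
  define h f g where "h = RN_deriv N L" and "f = RN_deriv L P" and "g = RN_deriv L Q"
  have mh[measurable]: "h \<in> borel_measurable N" by (simp add: h_def)
  have mf[measurable]: "f \<in> borel_measurable N" and mg[measurable]: "g \<in> borel_measurable N"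
    using borel_measurable_RN_deriv[of L P] borel_measurable_RN_deriv[of L Q]
    unfolding f_def g_def measurable_cong_sets[OF sL refl] by blast+
  note [measurable] = p(1) q(1)
  have dL: "density N h = L"
    unfolding h_def using acL sL by (rule N.density_RN_deriv)
  have dP: "density L f = P"
    unfolding f_def using acP sP sL by (intro L.density_RN_deriv) simp_all
  have dQ: "density L g = Q"
    unfolding g_def using acQ sQ sL by (intro L.density_RN_deriv) simp_all
  have "density N (\<lambda>y. h y * f y) = density N (\<lambda>y. ennreal (p y))"
    using dP p(3) by (simp add: dL[symmetric] density_density_eq)
  then have AEp: "AE y in N. h y * f y = ennreal (p y)"
    by (intro N.density_unique) auto
  have "density N (\<lambda>y. h y * g y) = density N (\<lambda>y. ennreal (q y))"
    using dQ q(3) by (simp add: dL[symmetric] density_density_eq)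
  then have AEq: "AE y in N. h y * g y = ennreal (q y)"
    by (intro N.density_unique) auto
  have AEh: "AE y in N. h y \<noteq> \<infinity>"
    unfolding h_def using acL sL L.sigma_finite_measure_axioms by (intro N.RN_deriv_finite) auto
  have dL': "L = density N (\<lambda>y. ennreal (enn2real (h y)))"
    unfolding dL[symmetric] using AEh by (intro density_cong) (auto simp: less_top)
  let ?F = "\<lambda>y. max 0 (enn2real (f y) - \<alpha> * enn2real (g y))"
  have "hockey_stick \<alpha> P Q = (\<integral>y. ?F y \<partial>L)"
    by (simp add: hockey_stick_def L_def f_def g_def)
  also have "\<dots> = (\<integral>y. enn2real (h y) *\<^sub>R ?F y \<partial>N)"
    by (subst dL', rule integral_density) auto
  also have "\<dots> = (\<integral>y. max 0 (p y - \<alpha> * q y) \<partial>N)"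
  proof (rule integral_cong_AE)
    show "AE y in N. enn2real (h y) *\<^sub>R ?F y = max 0 (p y - \<alpha> * q y)"
      using AEp AEq
    proof eventually_elim
      case (elim y)
      have "p y = enn2real (h y) * enn2real (f y)"
        using elim(1) p(2)[of y] by (metis enn2real_ennreal enn2real_mult)
      moreover have "q y = enn2real (h y) * enn2real (g y)"
        using elim(2) q(2)[of y] by (metis enn2real_ennreal enn2real_mult)
      ultimately show ?case
        by (simp add: max_mult_distrib_left algebra_simps)
    qed
  qed measurable
  finally show ?thesis .
qed

lemma hockey_stick_nonneg: "0 \<le> hockey_stick \<alpha> P Q"
  unfolding hockey_stick_def by (intro Bochner_Integration.integral_nonneg) simp

lemma hockey_stick_le_1:
  assumes "prob_space P" "prob_space Q" "sets Q = sets P" "0 \<le> \<alpha>"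
  shows "hockey_stick \<alpha> P Q \<le> 1"
proof -
  interpret P: prob_space P by fact
  interpret Q: prob_space Q by fact
  interpret L: finite_measure "sup P Q"
    by (rule finite_measure_sup[OF assms(3) P.finite_measure_axioms Q.finite_measure_axioms])
  let ?f = "\<lambda>y. enn2real (RN_deriv (sup P Q) P y)"
  have s: "sets P = sets (sup P Q)"
    using assms(3) by (simp add: sets_sup)
  note ac = absolutely_continuous_sup(1)[OF assms(3)]
  have int: "integrable (sup P Q) ?f" and val: "(\<integral>y. ?f y \<partial>(sup P Q)) = 1"
    using L.RN_deriv_integrable[OF P.sigma_finite_measure_axioms ac s, of "\<lambda>_. 1"]
      L.RN_deriv_integral[OF P.sigma_finite_measure_axioms ac s, of "\<lambda>_. 1"]
    by (simp_all add: P.prob_space)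
  have "hockey_stick \<alpha> P Q \<le> (\<integral>y. ?f y \<partial>(sup P Q))"
    unfolding hockey_stick_def using int assms(4)
    by (intro integral_mono_AE' AE_I2) auto
  then show ?thesis using val by simp
qed

end

theory Submission
  imports Defs
begin

text \<open>
  Write \<open>P = M x\<close>, \<open>Q = M x'\<close> with densities \<open>p\<close>, \<open>q\<close>. Integrating a test \<open>\<phi>\<close> against \<open>p - e\<^sup>\<epsilon> q\<close> never exceeds the integral of the positive part, so
  \<open>e\<^sup>-\<^sup>\<epsilon> (\<integral>\<phi> dP - \<delta> \<epsilon>) \<le> \<integral>\<phi> dQ\<close> for all \<open>\<epsilon>\<close>. Applied to \<open>\<phi>\<^sub>c\<^sub>1\<close> and to \<open>1 - \<phi>\<^sub>c\<close> for \<open>c \<noteq> c1\<close>,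
  this bounds \<open>\<integral>\<phi>\<^sub>c\<^sub>1 dQ + 1 - \<integral>\<phi>\<^sub>c dQ\<close> below by the sum of the two suprema, which is greater
  than \<open>1\<close>.
\<close>

lemma hypothesis_test_complement:
  "hypothesis_test Z \<phi> \<Longrightarrow> hypothesis_test Z (\<lambda>z. 1 - \<phi> z)"
  by (auto simp: hypothesis_test_def)

text \<open>The tests are given on \<open>Z\<close>, while integrals are taken over
  \<open>M x\<close>, which shares only its measurable sets with \<open>Z\<close>; this carries the
  tests across.\<close>

lemma hypothesis_test_cong_sets:
  "sets P = sets Z \<Longrightarrow> hypothesis_test P \<phi> \<longleftrightarrow> hypothesis_test Z \<phi>"
  using measurable_cong_sets[of P Z borel borel] sets_eq_imp_space_eq[of P Z]
  by (auto simp: hypothesis_test_def)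

lemma hypothesis_test_integrable:
  assumes "finite_measure P" "hypothesis_test P \<phi>"
  shows "integrable P \<phi>"
  using assms
  by (intro finite_measure.integrable_const_bound[where B = 1] AE_I2)
     (auto simp: hypothesis_test_def)

lemma hypothesis_test_diff_le_hockey_stick:
  assumes fin: "finite_measure P" "finite_measure Q" and sQP: "sets Q = sets P"
    and test: "hypothesis_test P \<phi>"
  shows "(\<integral>z. \<phi> z \<partial>P) - \<alpha> * (\<integral>z. \<phi> z \<partial>Q) \<le> hockey_stick \<alpha> P Q"
proof -
  interpret P: finite_measure P by fact
  interpret Q: finite_measure Q by fact
  define L where "L = sup P Q"
  interpret L: finite_measure L
    unfolding L_def by (rule finite_measure_sup[OF sQP fin])
  have sP: "sets P = sets L" and sQ: "sets Q = sets L"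
    using sQP by (simp_all add: L_def sets_sup)
  have acP: "absolutely_continuous L P" and acQ: "absolutely_continuous L Q"
    unfolding L_def using absolutely_continuous_sup[OF sQP] by simp_all
  define p q where "p = (\<lambda>z. enn2real (RN_deriv L P z))" and "q = (\<lambda>z. enn2real (RN_deriv L Q z))"
  have testL: "hypothesis_test L \<phi>" and testQ: "hypothesis_test Q \<phi>"
    using test hypothesis_test_cong_sets sP sQ by metis+
  have m: "\<phi> \<in> borel_measurable L" and b: "\<And>z. z \<in> space L \<Longrightarrow> 0 \<le> \<phi> z \<and> \<phi> z \<le> 1"
    using testL by (auto simp: hypothesis_test_def)
  \<comment> \<open>Integrating the constant 1 against \<open>P\<close> and \<open>Q\<close> shows
    that the densities themselves are integrable over \<open>L\<close>.\<close>
  have p: "integrable L p" and q: "integrable L q"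
    using L.RN_deriv_integrable[OF P.sigma_finite_measure_axioms acP sP, of "\<lambda>_. 1"]
      L.RN_deriv_integrable[OF Q.sigma_finite_measure_axioms acQ sQ, of "\<lambda>_. 1"]
    by (simp_all add: p_def q_def)
  have p\<phi>: "integrable L (\<lambda>z. p z * \<phi> z)" "(\<integral>z. \<phi> z \<partial>P) = (\<integral>z. p z * \<phi> z \<partial>L)"
    unfolding p_def
    using L.RN_deriv_integrable[OF P.sigma_finite_measure_axioms acP sP m]
      L.RN_deriv_integral[OF P.sigma_finite_measure_axioms acP sP m]
      hypothesis_test_integrable[OF fin(1) test] by simp_all
  have q\<phi>: "integrable L (\<lambda>z. q z * \<phi> z)" "(\<integral>z. \<phi> z \<partial>Q) = (\<integral>z. q z * \<phi> z \<partial>L)"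
    unfolding q_def
    using L.RN_deriv_integrable[OF Q.sigma_finite_measure_axioms acQ sQ m]
      L.RN_deriv_integral[OF Q.sigma_finite_measure_axioms acQ sQ m]
      hypothesis_test_integrable[OF fin(2) testQ] by simp_all
  have "(\<integral>z. \<phi> z \<partial>P) - \<alpha> * (\<integral>z. \<phi> z \<partial>Q) = (\<integral>z. p z * \<phi> z - \<alpha> * (q z * \<phi> z) \<partial>L)"
    using p\<phi> q\<phi> by simp
  also have "\<dots> \<le> (\<integral>z. max 0 (p z - \<alpha> * q z) \<partial>L)"
  proof (rule integral_mono)
    show "integrable L (\<lambda>z. p z * \<phi> z - \<alpha> * (q z * \<phi> z))"
      using p\<phi> q\<phi> by simp
    show "integrable L (\<lambda>z. max 0 (p z - \<alpha> * q z))"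
      using p q by (intro integrable_max) simp_all
    fix z assume "z \<in> space L"
    with b have "0 \<le> \<phi> z" "\<phi> z \<le> 1" by blast+
    \<comment> \<open>Passing to the positive part uses only \<open>\<phi> z\<close> \<ge> 0, and
      dropping the factor uses \<open>\<phi> z\<close> \<le> 1. The sign of \<alpha> does not
      matter.\<close>
    have "p z * \<phi> z - \<alpha> * (q z * \<phi> z) = (p z - \<alpha> * q z) * \<phi> z"
      by (simp add: algebra_simps)
    also have "\<dots> \<le> max 0 (p z - \<alpha> * q z) * \<phi> z"
      using \<open>0 \<le> \<phi> z\<close> by (intro mult_right_mono) simp_all
    also have "\<dots> \<le> max 0 (p z - \<alpha> * q z)"
      using \<open>0 \<le> \<phi> z\<close> \<open>\<phi> z \<le> 1\<close> by (intro mult_left_le) simp_all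
    finally show "p z * \<phi> z - \<alpha> * (q z * \<phi> z) \<le> max 0 (p z - \<alpha> * q z)" .
  qed
  also have "\<dots> = hockey_stick \<alpha> P Q"
    by (simp add: hockey_stick_def L_def p_def q_def)
  finally show ?thesis .
qed

lemma randomized_mechanismD:
  assumes "randomized_mechanism S Z M" "x \<in> S"
  shows "prob_space (M x)" "sets (M x) = sets Z"
  using assms by (auto simp: randomized_mechanism_def space_prob_algebra)

text \<open>A real \<open>Sup\<close> is an upper bound only for a bounded set. Since
  \<open>R\<close> stays inside \<open>S\<close>, all measures involved are probability measures on
  one sigma-algebra, so 1 is a bound.\<close>

lemma hockey_stick_le_privacy_profile:
  assumes M: "randomized_mechanism S Z M" and R: "R \<subseteq> S \<times> S" and "(x, x') \<in> R"
  shows "hockey_stick (exp \<epsilon>) (M x) (M x') \<le> privacy_profile M R \<epsilon>"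
  unfolding privacy_profile_def
proof (rule cSup_upper)
  show "hockey_stick (exp \<epsilon>) (M x) (M x')
      \<in> insert 0 {hockey_stick (exp \<epsilon>) (M x) (M x') | x x'. (x, x') \<in> R}"
    using assms(3) by blast
  have "hockey_stick (exp \<epsilon>) (M y) (M y') \<le> 1" if "(y, y') \<in> R" for y y'
    using that R randomized_mechanismD[OF M] by (intro hockey_stick_le_1) auto
  then show "bdd_above (insert 0 {hockey_stick (exp \<epsilon>) (M x) (M x') | x x'. (x, x') \<in> R})"
    by (intro bdd_aboveI[where M = 1]) auto
qed

text \<open>The hockey-stick bound at order \<open>exp \<epsilon>\<close>, solved for the integral
  over \<open>M x'\<close>, gives one lower bound per \<epsilon>; the supremum is the best of them.
  It is taken in \<open>ereal\<close> because it can be infinite for an empty relation, whose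
  profile is 0.\<close>

lemma SUP_privacy_profile_le_integral:
  assumes M: "randomized_mechanism S Z M" and R: "R \<subseteq> S \<times> S" "(x, x') \<in> R"
    and test: "hypothesis_test Z \<phi>" and a: "a \<le> (\<integral>z. \<phi> z \<partial>M x)"
  shows "(SUP \<epsilon>. ereal (exp (- \<epsilon>) * (a - privacy_profile M R \<epsilon>))) \<le> ereal (\<integral>z. \<phi> z \<partial>M x')"
proof (rule SUP_least)
  fix \<epsilon> :: real
  have S: "x \<in> S" "x' \<in> S" using R by auto
  note Mx = randomized_mechanismD[OF M S(1)] and Mx' = randomized_mechanismD[OF M S(2)]
  have "(\<integral>z. \<phi> z \<partial>M x) - exp \<epsilon> * (\<integral>z. \<phi> z \<partial>M x') \<le> hockey_stick (exp \<epsilon>) (M x) (M x')"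
    using Mx Mx' test hypothesis_test_cong_sets[OF Mx(2)]
    by (intro hypothesis_test_diff_le_hockey_stick prob_space.finite_measure) auto
  also have "\<dots> \<le> privacy_profile M R \<epsilon>"
    using M R by (rule hockey_stick_le_privacy_profile)
  finally have "a - privacy_profile M R \<epsilon> \<le> exp \<epsilon> * (\<integral>z. \<phi> z \<partial>M x')"
    using a by simp
  then have "exp (- \<epsilon>) * (a - privacy_profile M R \<epsilon>) \<le> exp (- \<epsilon>) * (exp \<epsilon> * (\<integral>z. \<phi> z \<partial>M x'))"
    by (rule mult_left_mono) simp
  also have "\<dots> = (\<integral>z. \<phi> z \<partial>M x')"
    by (simp add: exp_minus)
  finally show "ereal (exp (- \<epsilon>) * (a - privacy_profile M R \<epsilon>)) \<le> ereal (\<integral>z. \<phi> z \<partial>M x')"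
    by simp
qed

text \<open>The competitor \<open>c\<close> is arbitrary, since the runner-up at \<open>x'\<close>
  may differ from the one at \<open>x\<close>.\<close>

lemma class_score_less:
  assumes M: "randomized_mechanism S Z M" and R: "R \<subseteq> S \<times> S" "(x, x') \<in> R"
    and test: "hypothesis_test Z (\<phi> b)" "hypothesis_test Z (\<phi> c)"
    and scores: "p1 \<le> class_score M \<phi> x b" "class_score M \<phi> x c \<le> p2"
    and gt: "(SUP \<epsilon>. ereal (exp (- \<epsilon>) * (p1 - privacy_profile M R \<epsilon>)))
           + (SUP \<epsilon>. ereal (exp (- \<epsilon>) * (1 - p2 - privacy_profile M R \<epsilon>))) > 1"
  shows "class_score M \<phi> x' c < class_score M \<phi> x' b"
proof -
  have complement: "(\<integral>z. 1 - \<phi> c z \<partial>M y) = 1 - class_score M \<phi> y c" if "y \<in> S" for y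
  proof -
    note My = randomized_mechanismD[OF M that]
    interpret prob_space "M y" by (rule My)
    have "integrable (M y) (\<phi> c)"
      using test(2) hypothesis_test_cong_sets[OF My(2)] finite_measure_axioms
      by (intro hypothesis_test_integrable) auto
    then show ?thesis by (simp add: class_score_def prob_space)
  qed
  have S: "x \<in> S" "x' \<in> S" using R by auto
  have "(SUP \<epsilon>. ereal (exp (- \<epsilon>) * (p1 - privacy_profile M R \<epsilon>))) \<le> ereal (class_score M \<phi> x' b)"
    using scores(1) SUP_privacy_profile_le_integral[OF M R test(1)] by (simp add: class_score_def)
  moreover have "1 - p2 \<le> (\<integral>z. 1 - \<phi> c z \<partial>M x)"
    using complement[OF S(1)] scores(2) by simp
  from SUP_privacy_profile_le_integral[OF M R hypothesis_test_complement[OF test(2)] this]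
  have "(SUP \<epsilon>. ereal (exp (- \<epsilon>) * (1 - p2 - privacy_profile M R \<epsilon>)))
      \<le> ereal (1 - class_score M \<phi> x' c)"
    using complement[OF S(2)] by simp
  \<comment> \<open>Both upper bounds are finite, so this is an inequality between reals, in which
    the two ones cancel.\<close>
  ultimately have "1 < ereal (class_score M \<phi> x' b) + ereal (1 - class_score M \<phi> x' c)"
    using gt by (meson add_mono less_le_trans)
  then show ?thesis by (simp add: one_ereal_def)
qed

text \<open>A classifier may select any maximiser; a strict gap leaves it no choice.\<close>

lemma is_arg_max_unique:
  fixes f :: "'a \<Rightarrow> 'b::linorder"
  assumes "is_arg_max f P a" "P b" "\<And>c. P c \<Longrightarrow> c \<noteq> b \<Longrightarrow> f c < f b"
  shows "a = b"
  using assms by (auto simp: is_arg_max_def)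

theorem theorem4p1:
  fixes S :: "'x set" and d :: "'x \<Rightarrow> 'x \<Rightarrow> real" and \<rho> :: real
    and N :: nat and R :: "nat \<Rightarrow> 'x rel"
    and Z :: "'z measure" and M :: "'x \<Rightarrow> 'z measure" and \<delta> :: "nat \<Rightarrow> real \<Rightarrow> real"
    and C :: nat and \<phi> :: "nat \<Rightarrow> 'z \<Rightarrow> real" and g :: "'x \<Rightarrow> nat"
    and x :: 'x and c1 c2 :: nat and p1 p2 :: real
  assumes "Metric_space S d"
    and "\<rho> \<ge> 0"
    and "N \<ge> 1"
    and "\<And>i. i \<in> {1..N} \<Longrightarrow> R i \<subseteq> S \<times> S"
    and "\<And>y y'. y \<in> S \<Longrightarrow> y' \<in> S \<Longrightarrow> d y y' \<le> \<rho> \<longleftrightarrow> (\<exists>i\<in>{1..N}. (y, y') \<in> R i)"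
    and "randomized_mechanism S Z M"
    and "\<And>i. i \<in> {1..N} \<Longrightarrow> \<delta> i = privacy_profile M (R i)"
    and "C \<ge> 2"
    and "\<And>c. c \<in> {1..C} \<Longrightarrow> hypothesis_test Z (\<phi> c)"
    and "\<And>z. z \<in> space Z \<Longrightarrow> (\<Sum>c\<in>{1..C}. \<phi> c z) = 1"
    and "smoothed_classifier S M \<phi> C g"
    and "x \<in> S"
    and "majority_class M \<phi> C x c1"
    and "second_majority_class M \<phi> C x c1 c2"
    and "p1 \<in> {0..1}" and "p2 \<in> {0..1}"
    and "class_score M \<phi> x c1 \<ge> p1" and "p1 > p2" and "p2 \<ge> class_score M \<phi> x c2"
    and "Min ((\<lambda>i. (SUP \<epsilon>. ereal (exp (- \<epsilon>) * (p1 - \<delta> i \<epsilon>)))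
                 + (SUP \<epsilon>. ereal (exp (- \<epsilon>) * (1 - p2 - \<delta> i \<epsilon>)))) ` {1..N}) > 1"
  shows "robust_at S d \<rho> g x"
  unfolding robust_at_def
proof (intro ballI impI)
  fix x' assume x': "x' \<in> S" "d x' x \<le> \<rho>"
  interpret Metric_space S d by fact
  \<comment> \<open>The profile has to compare \<open>M x\<close> with \<open>M x'\<close> in this
    order, because the known scores are those at \<open>x\<close>; symmetry of the metric turns the
    pair around.\<close>
  have "d x x' \<le> \<rho>" using x'(2) commute by simp
  then obtain i where i: "i \<in> {1..N}" "(x, x') \<in> R i"
    using assms(5)[OF \<open>x \<in> S\<close> x'(1)] by blast
  have c1: "c1 \<in> {1..C}"
    using \<open>majority_class M \<phi> C x c1\<close> by (simp add: majority_class_def is_arg_max_def)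
  \<comment> \<open>As \<open>c2\<close> is maximal among the classes other than \<open>c1\<close>,
    its bound \<open>p2\<close> holds for all of them.\<close>
  have score_le: "class_score M \<phi> x c \<le> p2" if "c \<in> {1..C}" "c \<noteq> c1" for c
    using that \<open>second_majority_class M \<phi> C x c1 c2\<close> \<open>p2 \<ge> class_score M \<phi> x c2\<close>
    by (force simp: second_majority_class_def is_arg_max_linorder)
  have "g x = c1"
    using \<open>smoothed_classifier S M \<phi> C g\<close> \<open>x \<in> S\<close> c1 score_le
      \<open>p1 > p2\<close> \<open>class_score M \<phi> x c1 \<ge> p1\<close>
    by (intro is_arg_max_unique[of "class_score M \<phi> x" "\<lambda>c. c \<in> {1..C}"])
       (fastforce simp: smoothed_classifier_def)+
  moreover have "g x' = c1"
  proof (rule is_arg_max_unique[of "class_score M \<phi> x'" "\<lambda>c. c \<in> {1..C}"])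
    show "is_arg_max (class_score M \<phi> x') (\<lambda>c. c \<in> {1..C}) (g x')"
      using \<open>smoothed_classifier S M \<phi> C g\<close> x'(1) by (simp add: smoothed_classifier_def)
    show "c1 \<in> {1..C}" by (rule c1)
    fix c assume c: "c \<in> {1..C}" "c \<noteq> c1"
    \<comment> \<open>The component \<open>i\<close> containing the pair depends on
      \<open>x'\<close>, which is why the minimum over all components must exceed 1.\<close>
    have "(SUP \<epsilon>. ereal (exp (- \<epsilon>) * (p1 - \<delta> i \<epsilon>)))
        + (SUP \<epsilon>. ereal (exp (- \<epsilon>) * (1 - p2 - \<delta> i \<epsilon>))) > 1"
      using assms(20) i(1) by (subst (asm) Min_gr_iff) auto
    then show "class_score M \<phi> x' c < class_score M \<phi> x' c1"
      using assms(6) assms(4)[OF i(1)] i(2) assms(9)[OF c1] assms(9)[OF c(1)]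
        \<open>class_score M \<phi> x c1 \<ge> p1\<close> score_le[OF c] assms(7)[OF i(1)]
      by (intro class_score_less[of S Z M "R i" x x']) auto
  qed
  ultimately show "g x' = g x" by simp
qed

end
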